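(* Let $X,Y,Z_1,Z_2$ be real random variables such that $(X,Y)$ is independent of $(Z_1,Z_2)$, $Z_1$ and $Z_2$ are independent, and the copula of $(X,Y)$ is $C(u,v)$. Let $X,Y,Z_1,Z_2,X+Z_1,Y+Z_2$ have cumulative distribution functions $F_1,F_2,G_1,G_2,F_7,F_8$ respectively. Then the copula of $(X+Z_1,Y+Z_2)$ is $$C_7(u,v)=\int_{-\infty}^{\infty}\int_{-\infty}^{\infty}C\bigl(F_1(F_7^{-1}(u)-t_1),\,F_2(F_8^{-1}(v)-t_2)\bigr)\,dG_2(t_2)\,dG_1(t_1).$$ Moreover, when all the variables $X,Y,Z_1,Z_2$ are uniform on $(0,1)$, with $a(x)=1-\sqrt{2(1-x)}$ and $b(x)=\sqrt{2x}$, this formula gives: if $u\le 1/2$, $v\le 1/2$: $C_7(u,v)=\int_0^{b(u)}\int_0^{b(v)}C(b(u)-t_1,b(v)-t_2)\,dt_2dt_1$; if $u\le 1/2$, $v\ge 1/2$: $C_7(u,v)=\int_0^{b(u)}\int_{a(v)}^{1}C(b(u)-t_1,1+a(v)-t_2)\,dt_2dt_1+u\,a(v)$; if $u\ge 1/2$, $v\le 1/2$: $C_7(u,v)=\int_{a(u)}^{1}\int_0^{b(v)}C(1+a(u)-t_1,b(v)-t_2)\,dt_2dt_1+v\,a(u)$; if $u\ge 1/2$, $v\ge 1/2$: $C_7(u,v)=\int_{a(u)}^{1}\int_{a(v)}^{1}C(1+a(u)-t_1,1+a(v)-t_2)\,dt_2dt_1+u\,a(v)+v\,a(u)-a(u)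a(v)$.
   Context: A 2-copula is a function $C:[0,1]^2\to[0,1]$ with $C(0,x)=C(x,0)=0$, $C(1,x)=C(x,1)=x$ for all $x\in[0,1]$ and $C(x_1,y_1)+C(x_2,y_2)-C(x_1,y_2)-C(x_2,y_1)\ge 0$ for all $[x_1,x_2]\times[y_1,y_2]\subset[0,1]^2$. For random variables $V,W$ with joint distribution function $H$ and marginal distribution functions $F,G$, the copula of $(V,W)$ is the 2-copula $C$ with $C(F(x),G(y))=H(x,y)$ for all real $x,y$; it is unique if the variables are continuous. For a distribution function $F$, $F^{-1}(t)=\inf\{x: F(x)=t\}$.
   Formalization: That C_7 is the (unique) copula is stated for continuous F_7, F_8 (at jumps F_7^{-1}(u) is undefined; C_7(F_7(x),F_8(y))=P(X+Z_1≤x, Y+Z_2≤y) is stated without continuity); F^{-1} is taken in the extended reals, so F^{-1}(0) = -∞. *)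

theory Defs
  imports "HOL-Probability.Probability"
begin

text \<open>
  Copulas are represented by functions on all of \<open>real \<times> real\<close>, of which only the values on
  the unit square matter.
\<close>

definition two_copula :: "(real \<Rightarrow> real \<Rightarrow> real) \<Rightarrow> bool" where
  "two_copula C \<longleftrightarrow>
     (\<forall>u\<in>{0..1}. \<forall>v\<in>{0..1}. C u v \<in> {0..1}) \<and>
     (\<forall>x\<in>{0..1}. C 0 x = 0 \<and> C x 0 = 0 \<and> C 1 x = x \<and> C x 1 = x) \<and>
     (\<forall>x1 x2 y1 y2. 0 \<le> x1 \<and> x1 \<le> x2 \<and> x2 \<le> 1 \<and> 0 \<le> y1 \<and> y1 \<le> y2 \<and> y2 \<le> 1 \<longrightarrow>
        C x1 y1 + C x2 y2 - C x1 y2 - C x2 y1 \<ge> 0)"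

definition copula_of ::
  "'a measure \<Rightarrow> ('a \<Rightarrow> real) \<Rightarrow> ('a \<Rightarrow> real) \<Rightarrow> (real \<Rightarrow> real \<Rightarrow> real) \<Rightarrow> bool" where
  "copula_of M V W C \<longleftrightarrow>
     two_copula C \<and>
     (\<forall>x y. C (cdf (distr M borel V) x) (cdf (distr M borel W) y) =
            measure M {\<omega> \<in> space M. V \<omega> \<le> x \<and> W \<omega> \<le> y})"

text \<open>
  A distribution function is extended to \<open>[-\<infinity>, \<infinity>]\<close> by its limits \<open>0\<close> and \<open>1\<close>. The inverse
  \<open>inf {x. F x = t}\<close> is taken in the extended reals, so that it is \<open>-\<infinity>\<close> at \<open>t = 0\<close> also when
  \<open>F\<close> is positive everywhere, and \<open>\<infinity>\<close> at \<open>t = 1\<close> when \<open>F\<close> never attains \<open>1\<close>.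
\<close>

definition ext_df :: "(real \<Rightarrow> real) \<Rightarrow> ereal \<Rightarrow> real" where
  "ext_df F x = (case x of ereal r \<Rightarrow> F r | PInfty \<Rightarrow> 1 | MInfty \<Rightarrow> 0)"

definition df_inv :: "(real \<Rightarrow> real) \<Rightarrow> real \<Rightarrow> ereal" where
  "df_inv F t = Inf {x. ext_df F x = t}"

end

theory Submission
  imports Defs
begin

text \<open>
  Conditioning on \<open>(Z1, Z2)\<close> turns the double integral of \<open>C (F1 (x - t1)) (F2 (y - t2))\<close> into
  the joint probability of \<open>X + Z1 \<le> x\<close> and \<open>Y + Z2 \<le> y\<close>, also for infinite \<open>x\<close> and \<open>y\<close>. This
  probability depends on \<open>x\<close> and \<open>y\<close> only through \<open>F7 x\<close> and \<open>F8 y\<close>, since \<open>V \<le> x\<close> and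
  \<open>V \<le> x'\<close> agree almost surely when they are equally likely; so any choice of preimage of \<open>u\<close>
  under \<open>F7\<close> may replace \<open>df_inv F7 u\<close>. In the uniform case the preimages are \<open>b u\<close> and
  \<open>1 + a u\<close>, and the integrals over \<open>{0..1}\<close> split where a distribution function of the
  integrand reaches \<open>0\<close> or \<open>1\<close>.
\<close>

section \<open>Distribution functions on the extended reals\<close>

text \<open>A measure is determined by its distribution function, so the Stieltjes integrals against
  \<open>G1\<close> and \<open>G2\<close> are integrals against the laws of \<open>Z1\<close> and
  \<open>Z2\<close>.\<close>

lemma interval_measure_cdf:
  assumes "real_distribution D"
  shows "interval_measure (cdf D) = D"
proof -
  interpret real_distribution D by fact
  show ?thesis
    by (rule cdf_unique[OF real_distribution_interval_measure assms cdf_interval_measure])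
      (auto intro: cdf_nondecreasing cdf_is_right_cont cdf_lim_at_bot cdf_lim_at_top_prob)
qed

text \<open>At the infinite points the ray is empty or the whole line. Reading \<open>ext_df\<close>
  as a probability avoids separate treatment of finite and infinite arguments later.\<close>

lemma (in real_distribution) ext_df_cdf: "ext_df (cdf M) x = measure M {r. ereal r \<le> x}"
  using prob_space by (cases x) (auto simp: ext_df_def cdf_def atMost_def)

text \<open>The infimum defining \<open>df_inv\<close> is attained as soon as the level set is
  nonempty: a decreasing sequence in the set tends to it, and continuity of the measure from above
  carries the value \<open>t\<close> to the limit, even when that limit is
  \<open>-\<infinity>\<close>.\<close>

lemma (in real_distribution) ext_df_df_inv:
  assumes "ext_df (cdf M) x = t"
  shows "ext_df (cdf M) (df_inv (cdf M) t) = t"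
proof -
  let ?S = "{x. ext_df (cdf M) x = t}"
  have "?S \<noteq> {}" using assms by auto
  then obtain f :: "nat \<Rightarrow> ereal"
    where f: "decseq f" "range f \<subseteq> ?S" "Inf ?S = (INF i. f i)"
    using Inf_countable_INF by metis
  have "(\<lambda>n. measure M {r. ereal r \<le> f n}) \<longlonglongrightarrow> measure M (\<Inter>n. {r. ereal r \<le> f n})"
    using f(1) by (intro finite_Lim_measure_decseq) (auto simp: decseq_def intro: order_trans)
  moreover have "(\<Inter>n. {r. ereal r \<le> f n}) = {r. ereal r \<le> Inf ?S}"
    unfolding f(3) by (auto simp: le_INF_iff)
  moreover have "measure M {r. ereal r \<le> f n} = t" for n
    using f(2) by (auto simp: ext_df_cdf)
  ultimately show ?thesis
    by (simp add: ext_df_cdf df_inv_def LIMSEQ_const_iff)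
qed

text \<open>Values strictly between 0 and 1 come from the intermediate value theorem. The values 0
  and 1 may be attained at no real point, so the infinite points serve for them.\<close>

lemma (in real_distribution) ext_df_cdf_surj:
  assumes "continuous_on UNIV (cdf M)" "t \<in> {0..1}"
  shows "\<exists>x. ext_df (cdf M) x = t"
proof (cases "t = 0 \<or> t = 1")
  case True
  then show ?thesis
    by (auto simp: ext_df_def intro: exI[of _ "\<infinity>"] exI[of _ "-\<infinity>"])
next
  case False
  with assms(2) have t: "0 < t" "t < 1" by auto
  obtain a where a: "cdf M a < t"
    using order_tendstoD(2)[OF cdf_lim_at_bot t(1)] by (auto simp: eventually_at_bot_linorder)
  obtain b where b: "t < cdf M b"
    using order_tendstoD(1)[OF cdf_lim_at_top_prob t(2)] by (auto simp: eventually_at_top_linorder)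
  have "a \<le> b"
    using a b cdf_nondecreasing[of b a] by linarith
  then obtain x where "cdf M x = t"
    using IVT'[of "cdf M" a t b] a b assms(1) continuous_on_subset by fastforce
  then show ?thesis
    by (auto simp: ext_df_def intro: exI[of _ "ereal x"])
qed

section \<open>Joint probabilities of two random variables and their copulas\<close>

context prob_space
begin

lemma ext_df_distr:
  assumes [measurable]: "random_variable borel V"
  shows "ext_df (cdf (distr M borel V)) x = prob {\<omega> \<in> space M. ereal (V \<omega>) \<le> x}"
proof -
  interpret V: real_distribution "distr M borel V" by simp
  show ?thesis
    by (simp add: V.ext_df_cdf measure_distr vimage_def Int_def conj_commute)
qed

text \<open>The two events are nested, since the bounds are comparable; with equal probability their
  difference is a null set.\<close>

lemma AE_le_iff_if_prob_eq:
  fixes V :: "'a \<Rightarrow> real" and x x' :: ereal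
  assumes [measurable]: "random_variable borel V"
    and eq: "prob {\<omega> \<in> space M. ereal (V \<omega>) \<le> x} = prob {\<omega> \<in> space M. ereal (V \<omega>) \<le> x'}"
  shows "AE \<omega> in M. ereal (V \<omega>) \<le> x \<longleftrightarrow> ereal (V \<omega>) \<le> x'"
  using eq
proof (induction x x' rule: linorder_wlog)
  case (le x x')
  have "prob ({\<omega> \<in> space M. ereal (V \<omega>) \<le> x'} - {\<omega> \<in> space M. ereal (V \<omega>) \<le> x}) = 0"
    using le by (subst finite_measure_Diff) (auto intro: order_trans)
  then have "AE \<omega> in M. \<omega> \<notin> {\<omega> \<in> space M. ereal (V \<omega>) \<le> x'} - {\<omega> \<in> space M. ereal (V \<omega>) \<le> x}"
    by (subst (asm) prob_eq_0) auto
  then show ?case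
    using AE_space by eventually_elim (use le(1) in \<open>auto intro: order_trans\<close>)
next
  case (sym x x')
  then show ?case by (auto simp: eq_commute)
qed

text \<open>Each marginal event changes only by a null set, hence so does the intersection. This
  makes the joint probability a well-defined function of the two marginal values.\<close>

lemma joint_prob_cong:
  fixes V W :: "'a \<Rightarrow> real" and x x' y y' :: ereal
  assumes V[measurable]: "random_variable borel V" and W[measurable]: "random_variable borel W"
    and "prob {\<omega> \<in> space M. ereal (V \<omega>) \<le> x} = prob {\<omega> \<in> space M. ereal (V \<omega>) \<le> x'}"
    and "prob {\<omega> \<in> space M. ereal (W \<omega>) \<le> y} = prob {\<omega> \<in> space M. ereal (W \<omega>) \<le> y'}"
  shows "prob {\<omega> \<in> space M. ereal (V \<omega>) \<le> x \<and> ereal (W \<omega>) \<le> y} =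
    prob {\<omega> \<in> space M. ereal (V \<omega>) \<le> x' \<and> ereal (W \<omega>) \<le> y'}"
proof (rule finite_measure_eq_AE)
  show "AE \<omega> in M. \<omega> \<in> {\<omega> \<in> space M. ereal (V \<omega>) \<le> x \<and> ereal (W \<omega>) \<le> y} \<longleftrightarrow>
      \<omega> \<in> {\<omega> \<in> space M. ereal (V \<omega>) \<le> x' \<and> ereal (W \<omega>) \<le> y'}"
    using AE_le_iff_if_prob_eq[OF V assms(3)] AE_le_iff_if_prob_eq[OF W assms(4)]
    by eventually_elim auto
qed auto

text \<open>Inclusion-exclusion for \<open>A1 \<inter> B2\<close> and \<open>A2 \<inter> B1\<close>:
  they meet in \<open>A1 \<inter> B1\<close>, and their union lies in
  \<open>A2 \<inter> B2\<close>.\<close>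

lemma prob_rectangle_nonneg:
  assumes [measurable]: "A1 \<in> events" "A2 \<in> events" "B1 \<in> events" "B2 \<in> events"
    and "A1 \<subseteq> A2" "B1 \<subseteq> B2"
  shows "prob (A1 \<inter> B1) + prob (A2 \<inter> B2) - prob (A1 \<inter> B2) - prob (A2 \<inter> B1) \<ge> 0"
proof -
  have "prob (A1 \<inter> B2 \<union> A2 \<inter> B1) =
      prob (A1 \<inter> B2) + prob (A2 \<inter> B1) - prob ((A1 \<inter> B2) \<inter> (A2 \<inter> B1))"
    by (rule measure_Un3) (auto simp: fmeasurable_eq_sets)
  moreover have "(A1 \<inter> B2) \<inter> (A2 \<inter> B1) = A1 \<inter> B1"
    using assms by auto
  moreover have "prob (A1 \<inter> B2 \<union> A2 \<inter> B1) \<le> prob (A2 \<inter> B2)"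
    using assms by (intro finite_measure_mono) auto
  ultimately show ?thesis by simp
qed

text \<open>Here \<open>q\<close> and \<open>r\<close> are arbitrary right inverses of the extended
  marginal distribution functions. The boundary values follow by exchanging \<open>q 0\<close> and
  \<open>q 1\<close> for infinite points, the rectangle inequality from
  \<open>prob_rectangle_nonneg\<close>.\<close>

lemma two_copula_joint_prob:
  fixes V W :: "'a \<Rightarrow> real" and q r :: "real \<Rightarrow> ereal"
  assumes V[measurable]: "random_variable borel V" and W[measurable]: "random_variable borel W"
    and q: "\<And>u. u \<in> {0..1} \<Longrightarrow> prob {\<omega> \<in> space M. ereal (V \<omega>) \<le> q u} = u"
    and r: "\<And>v. v \<in> {0..1} \<Longrightarrow> prob {\<omega> \<in> space M. ereal (W \<omega>) \<le> r v} = v"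
    and D: "\<And>u v. u \<in> {0..1} \<Longrightarrow> v \<in> {0..1} \<Longrightarrow>
      D u v = prob {\<omega> \<in> space M. ereal (V \<omega>) \<le> q u \<and> ereal (W \<omega>) \<le> r v}"
  shows "two_copula D"
proof -
  \<comment> \<open>A right inverse is automatically monotone: \<open>f t < f s\<close> would give
    \<open>t \<le> s\<close> on passing to probabilities, hence \<open>s = t\<close>, which is
    absurd.\<close>
  have mono: "f s \<le> f t"
    if f: "\<And>u. u \<in> {0..1} \<Longrightarrow> prob {\<omega> \<in> space M. ereal (U \<omega>) \<le> f u} = u"
      and st: "0 \<le> s" "s \<le> t" "t \<le> 1"
      and [measurable]: "random_variable borel U" for f U and s t :: real
  proof (rule ccontr)
    assume neg: "\<not> f s \<le> f t"
    then have "prob {\<omega> \<in> space M. ereal (U \<omega>) \<le> f t} \<le> prob {\<omega> \<in> space M. ereal (U \<omega>) \<le> f s}"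
      by (intro finite_measure_mono) (auto intro: order_trans)
    with f[of s] f[of t] st have "s = t" by auto
    with neg show False by simp
  qed
  \<comment> \<open>Level 0 is also attained at \<open>-\<infinity>\<close>, where the event is
    empty; below, level 1 is also attained at \<open>\<infinity>\<close>, where the condition is
    vacuous.\<close>
  have D0: "D 0 v = 0" if v: "v \<in> {0..1}" for v
    using joint_prob_cong[OF V W, of "q 0" "-\<infinity>" "r v" "r v"] q[of 0] D[of 0 v] v by simp
  have D0': "D v 0 = 0" if v: "v \<in> {0..1}" for v
    using joint_prob_cong[OF V W, of "q v" "q v" "r 0" "-\<infinity>"] r[of 0] D[of v 0] v by simp
  have D1: "D 1 v = v" if v: "v \<in> {0..1}" for v
    using joint_prob_cong[OF V W, of "q 1" "\<infinity>" "r v" "r v"] q[of 1] r[of v] D[of 1 v] v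
    by (simp add: prob_space)
  have D1': "D v 1 = v" if v: "v \<in> {0..1}" for v
    using joint_prob_cong[OF V W, of "q v" "q v" "r 1" "\<infinity>"] r[of 1] q[of v] D[of v 1] v
    by (simp add: prob_space)
  have "D x1 y1 + D x2 y2 - D x1 y2 - D x2 y1 \<ge> 0"
    if h: "0 \<le> x1" "x1 \<le> x2" "x2 \<le> 1" "0 \<le> y1" "y1 \<le> y2" "y2 \<le> 1" for x1 x2 y1 y2
  proof -
    let ?A = "\<lambda>x. {\<omega> \<in> space M. ereal (V \<omega>) \<le> q x}"
    let ?B = "\<lambda>y. {\<omega> \<in> space M. ereal (W \<omega>) \<le> r y}"
    have "D x y = prob (?A x \<inter> ?B y)" if "x \<in> {0..1}" "y \<in> {0..1}" for x y
      unfolding D[OF that] by (rule arg_cong[where f=prob]) auto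
    moreover have "?A x1 \<subseteq> ?A x2" "?B y1 \<subseteq> ?B y2"
      using mono[OF q h(1-3) V] mono[OF r h(4-6) W] by (auto intro: order_trans)
    ultimately show ?thesis
      using prob_rectangle_nonneg[of "?A x1" "?A x2" "?B y1" "?B y2"] h by auto
  qed
  then show ?thesis
    unfolding two_copula_def using D0 D0' D1 D1' D by auto
qed

text \<open>The definition of \<open>copula_of\<close> covers real points only; at infinite points
  the boundary values of \<open>C\<close> match an empty event or a marginal one.\<close>

lemma copula_of_ext_df:
  assumes [measurable]: "random_variable borel V" "random_variable borel W"
    and C: "copula_of M V W C"
  shows "C (ext_df (cdf (distr M borel V)) x) (ext_df (cdf (distr M borel W)) y) =
    prob {\<omega> \<in> space M. ereal (V \<omega>) \<le> x \<and> ereal (W \<omega>) \<le> y}"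
proof -
  have c: "C 0 t = 0" "C t 0 = 0" "C 1 t = t" "C t 1 = t" if "t \<in> {0..1}" for t
    using C that by (auto simp: copula_of_def two_copula_def)
  show ?thesis
  proof (cases "x \<in> {\<infinity>, -\<infinity>} \<or> y \<in> {\<infinity>, -\<infinity>}")
    case True
    then show ?thesis
      by (auto simp: ext_df_distr c prob_space)
  next
    case False
    then obtain r s where "x = ereal r" "y = ereal s"
      by (cases x; cases y) auto
    then show ?thesis
      using C by (simp add: copula_of_def ext_df_def)
  qed
qed

text \<open>Fubini twice: the joint law is the product of the laws of \<open>(X, Y)\<close> and
  \<open>(Z1, Z2)\<close>, and the latter is itself a product. Fixing the values of
  \<open>(Z1, Z2)\<close> shifts the quadrant.\<close>

lemma prob_add_le_convolution:
  fixes X Y Z1 Z2 :: "'a \<Rightarrow> real" and x y :: ereal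
  assumes ind: "indep_var borel (\<lambda>\<omega>. (X \<omega>, Y \<omega>)) borel (\<lambda>\<omega>. (Z1 \<omega>, Z2 \<omega>))"
    and indZ: "indep_var borel Z1 borel Z2"
    and [measurable]: "random_variable borel X" "random_variable borel Y"
    "random_variable borel Z1" "random_variable borel Z2"
  shows "prob {\<omega> \<in> space M. ereal (X \<omega> + Z1 \<omega>) \<le> x \<and> ereal (Y \<omega> + Z2 \<omega>) \<le> y} =
    (\<integral>t1. (\<integral>t2. prob {\<omega> \<in> space M. ereal (X \<omega>) \<le> x - ereal t1 \<and> ereal (Y \<omega>) \<le> y - ereal t2}
      \<partial>distr M borel Z2) \<partial>distr M borel Z1)"
proof -
  let ?P = "distr M borel (\<lambda>\<omega>. (X \<omega>, Y \<omega>))" and ?Q = "distr M borel (\<lambda>\<omega>. (Z1 \<omega>, Z2 \<omega>))"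
  let ?N1 = "distr M borel Z1" and ?N2 = "distr M borel Z2"
  interpret P: prob_space ?P by (rule prob_space_distr) measurable
  interpret Q: prob_space ?Q by (rule prob_space_distr) measurable
  interpret N1: prob_space ?N1 by (rule prob_space_distr) measurable
  interpret N2: prob_space ?N2 by (rule prob_space_distr) measurable
  interpret PQ: pair_prob_space ?P ?Q ..
  interpret N: pair_prob_space ?N1 ?N2 ..
  have PQ: "?P \<Otimes>\<^sub>M ?Q = distr M (borel \<Otimes>\<^sub>M borel) (\<lambda>\<omega>. ((X \<omega>, Y \<omega>), (Z1 \<omega>, Z2 \<omega>)))"
    using ind by (simp add: indep_var_distribution_eq)
  have N: "?N1 \<Otimes>\<^sub>M ?N2 = ?Q"
    using indZ by (simp add: indep_var_distribution_eq borel_prod)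
  define A :: "((real \<times> real) \<times> (real \<times> real)) set" where
    "A = {p. ereal (fst (fst p) + fst (snd p)) \<le> x \<and> ereal (snd (fst p) + snd (snd p)) \<le> y}"
  have "Measurable.pred ((borel \<Otimes>\<^sub>M borel) \<Otimes>\<^sub>M (borel \<Otimes>\<^sub>M borel)) (\<lambda>p. p \<in> A)"
    unfolding A_def mem_Collect_eq by measurable
  then have A[measurable]: "A \<in> sets (borel \<Otimes>\<^sub>M borel)"
    unfolding borel_prod by (simp add: pred_def)
  have sec: "measure ?P ((\<lambda>p. (p, t)) -` A) =
      prob {\<omega> \<in> space M. ereal (X \<omega>) \<le> x - ereal (fst t) \<and> ereal (Y \<omega>) \<le> y - ereal (snd t)}" for t
  proof -
    have "(\<lambda>p. (p, t)) -` A \<in> sets borel"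
      using sets_Pair2[OF A] by (simp add: vimage_def)
    \<comment> \<open>For infinite \<open>z\<close> the shift leaves \<open>z\<close> unchanged, so
      both sides hold or both fail.\<close>
    moreover have "ereal (a + c) \<le> z \<longleftrightarrow> ereal a \<le> z - ereal c" for a c z
      by (cases z) (auto simp: algebra_simps)
    ultimately show ?thesis
      by (subst measure_distr) (auto simp: A_def intro!: arg_cong[where f=prob])
  qed
  let ?f = "\<lambda>t. measure ?P ((\<lambda>p. (p, t)) -` A)"
  have int: "integrable (?P \<Otimes>\<^sub>M ?Q) (\<lambda>(p, t). indicator A (p, t) :: real)"
    by (auto intro!: PQ.P.integrable_const_bound[where B=1])
  have f: "(\<integral>p. indicator A (p, t) \<partial>?P) = ?f t" for t
  proof -
    have "(\<lambda>p. indicator A (p, t) :: real) = indicator ((\<lambda>p. (p, t)) -` A)"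
      by (auto simp: indicator_def)
    then show ?thesis by simp
  qed
  \<comment> \<open>The first use of Fubini yields the integrability that the second one
    requires.\<close>
  have intf: "integrable (?N1 \<Otimes>\<^sub>M ?N2) ?f"
    using PQ.integrable_snd[OF int] unfolding f N .
  have "prob {\<omega> \<in> space M. ereal (X \<omega> + Z1 \<omega>) \<le> x \<and> ereal (Y \<omega> + Z2 \<omega>) \<le> y} =
      measure (?P \<Otimes>\<^sub>M ?Q) A"
    unfolding PQ by (subst measure_distr[OF _ A]) (measurable, auto simp: A_def intro!: arg_cong[where f=prob])
  also have "\<dots> = (\<integral>(p, t). indicator A (p, t) \<partial>(?P \<Otimes>\<^sub>M ?Q))"
    by simp
  also have "\<dots> = (\<integral>t. ?f t \<partial>?Q)"
    unfolding PQ.integral_snd[OF int, symmetric] f ..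
  also have "\<dots> = (\<integral>t1. (\<integral>t2. ?f (t1, t2) \<partial>?N2) \<partial>?N1)"
    unfolding N.integral_fst'[OF intf] N ..
  finally show ?thesis
    unfolding sec by simp
qed

end

section \<open>Uniform variables\<close>

text \<open>This is the distribution function of the uniform law on \<open>(0,1)\<close>. As a
  retraction onto \<open>{0..1}\<close> it also keeps the arguments of \<open>C\<close> where the
  copula axioms apply.\<close>

definition unit_clamp :: "real \<Rightarrow> real" where
  "unit_clamp s = max 0 (min 1 s)"

lemma unit_clamp_mem [simp]: "unit_clamp s \<in> {0..1}"
  by (simp add: unit_clamp_def)

lemma unit_clamp_bounds [simp]: "0 \<le> unit_clamp s" "unit_clamp s \<le> 1"
  by (auto simp: unit_clamp_def)

lemma unit_clamp_eq [simp]: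
  "0 \<le> s \<Longrightarrow> s \<le> 1 \<Longrightarrow> unit_clamp s = s" "s \<le> 0 \<Longrightarrow> unit_clamp s = 0" "1 \<le> s \<Longrightarrow> unit_clamp s = 1"
  by (auto simp: unit_clamp_def)

lemma unit_clamp_mono: "s \<le> t \<Longrightarrow> unit_clamp s \<le> unit_clamp t"
  by (auto simp: unit_clamp_def)

lemma cdf_uniform_unit: "cdf (uniform_measure lborel {0<..<1}) = unit_clamp"
proof
  fix s :: real
  have "{0<..<1} \<inter> {..s} = (if s \<le> 0 then {} else if s < 1 then {0<..s} else {0<..<1})"
    by auto
  then show "cdf (uniform_measure lborel {0<..<1}) s = unit_clamp s"
    by (auto simp: cdf_def unit_clamp_def)
qed

text \<open>The density is 1 on the open interval; passing to the closed one changes it only at the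
  null set of endpoints.\<close>

lemma integral_uniform_unit:
  fixes f :: "real \<Rightarrow> real"
  assumes [measurable]: "f \<in> borel_measurable borel"
  shows "(\<integral>t. f t \<partial>uniform_measure lborel {0<..<1}) = (LBINT t:{0..1}. f t)"
proof -
  have "uniform_measure lborel {0<..<1::real} = density lborel (\<lambda>t. ennreal (indicator {0..1} t))"
    unfolding uniform_measure_def
  proof (rule density_cong)
    show "AE t :: real in lborel. indicator {0<..<1} t / emeasure lborel {0<..<1::real} =
        ennreal (indicator {0..1} t)"
      using AE_lborel_singleton[of 0] AE_lborel_singleton[of 1]
      by eventually_elim (auto simp: indicator_def)
  qed auto
  then show ?thesis
    by (simp add: integral_density set_lebesgue_integral_def)
qed

text \<open>Clamping extends a function monotone on \<open>{0..1}\<close> to one monotone on the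
  whole line. Measurability of copula sections is obtained this way.\<close>

lemma borel_measurable_mono_on_unit_clamp:
  fixes f :: "real \<Rightarrow> real"
  assumes "mono_on {0..1} f"
  shows "(\<lambda>t. f (unit_clamp (x - t))) \<in> borel_measurable borel"
proof -
  have "mono (\<lambda>s. f (unit_clamp s))"
    using assms unit_clamp_mem by (auto simp: mono_def mono_on_def unit_clamp_mono)
  from borel_measurable_mono[OF this] have [measurable]: "(\<lambda>s. f (unit_clamp s)) \<in> borel_measurable borel" .
  show ?thesis by measurable
qed

text \<open>The values lie between \<open>f 0\<close> and \<open>f 1\<close>, and the interval of
  integration has finite measure.\<close>

lemma set_integrable_mono_on_unit_clamp:
  fixes f :: "real \<Rightarrow> real"
  assumes "mono_on {0..1} f"
  shows "set_integrable lborel {c..d} (\<lambda>t. f (unit_clamp (x - t)))"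
  unfolding set_integrable_def
proof (rule integrableI_bounded_set_indicator[where B="\<bar>f 0\<bar> + \<bar>f 1\<bar>"])
  show "(\<lambda>t. f (unit_clamp (x - t))) \<in> borel_measurable lborel"
    using borel_measurable_mono_on_unit_clamp[OF assms] by simp
  have "f 0 \<le> f (unit_clamp s)" "f (unit_clamp s) \<le> f 1" for s
    using assms unit_clamp_mem[of s] by (auto simp: mono_on_def)
  then show "AE t in lborel. t \<in> {c..d} \<longrightarrow> norm (f (unit_clamp (x - t))) \<le> \<bar>f 0\<bar> + \<bar>f 1\<bar>"
    by (intro AE_I2) (smt (verit) real_norm_def)
qed (auto simp: emeasure_lborel_Icc_eq)

text \<open>For \<open>t\<close> in \<open>{0..x}\<close> the clamp is idle; beyond \<open>x\<close>
  it gives 0, where \<open>f\<close> vanishes.\<close>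

lemma integral_unit_clamp_low:
  fixes f :: "real \<Rightarrow> real"
  assumes "x \<in> {0..1}" "f 0 = 0"
  shows "(LBINT t:{0..1}. f (unit_clamp (x - t))) = (LBINT t:{0..x}. f (x - t))"
  unfolding set_lebesgue_integral_def using assms
  by (intro Bochner_Integration.integral_cong) (auto simp: indicator_def)

text \<open>Up to \<open>c\<close> the argument is at least 1, so this piece contributes
  \<open>c * f 1\<close>; from \<open>c\<close> on the clamp is idle. Monotonicity supplies the
  integrability for splitting.\<close>

lemma integral_unit_clamp_high:
  fixes f :: "real \<Rightarrow> real"
  assumes c: "c \<in> {0..1}" and f: "mono_on {0..1} f"
  shows "(LBINT t:{0..1}. f (unit_clamp (1 + c - t))) = (LBINT t:{c..1}. f (1 + c - t)) + c * f 1"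
proof -
  have "(LBINT t:{0..1}. f (unit_clamp (1 + c - t))) = (LBINT t:{0..c} \<union> {c..1}. f (unit_clamp (1 + c - t)))"
    using c by (simp add: ivl_disj_un_two_touch)
  also have "\<dots> = (LBINT t:{0..c}. f (unit_clamp (1 + c - t))) + (LBINT t:{c..1}. f (unit_clamp (1 + c - t)))"
  proof (rule set_integral_Un_AE)
    show "AE t in lborel. \<not> (t \<in> {0..c} \<and> t \<in> {c..1})"
      using AE_lborel_singleton[of c] by eventually_elim auto
  qed (auto intro: set_integrable_mono_on_unit_clamp[OF f])
  also have "(LBINT t:{0..c}. f (unit_clamp (1 + c - t))) = (LBINT t:{0..c}. f 1)"
    by (rule set_lebesgue_integral_cong) auto
  also have "\<dots> = c * f 1"
    using c by (simp add: set_lebesgue_integral_def)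
  also have "(LBINT t:{c..1}. f (unit_clamp (1 + c - t))) = (LBINT t:{c..1}. f (1 + c - t))"
    using c by (intro set_lebesgue_integral_cong) auto
  finally show ?thesis by simp
qed

lemma integral_reflected_identity:
  fixes c d x :: real
  assumes "c \<le> d"
  shows "(LBINT t:{c..d}. x - t) = ((x - c)\<^sup>2 - (x - d)\<^sup>2) / 2"
proof -
  \<comment> \<open>The antiderivative used is \<open>- (x - t)\<^sup>2 / 2\<close>.\<close>
  have "(\<integral>t. (x - t) * indicator {c..d} t \<partial>lborel) = - (x - d)\<^sup>2 / 2 - - (x - c)\<^sup>2 / 2"
    using assms by (intro integral_FTC_Icc_real) (auto intro!: derivative_eq_intros simp: field_simps)
  then show ?thesis
    by (simp add: set_lebesgue_integral_def mult.commute field_simps)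
qed

text \<open>As a function of \<open>x\<close>, the integral of \<open>unit_clamp (x - t)\<close> is
  the distribution function of a sum of two independent uniform variables:
  \<open>x\<^sup>2 / 2\<close> on \<open>{0..1}\<close> and \<open>1 - (2 - x)\<^sup>2 / 2\<close>
  on \<open>{1..2}\<close>. The square roots invert these two branches.\<close>

lemma integral_unit_clamp_sqrt:
  assumes "u \<in> {0..1}"
  shows "u \<le> 1/2 \<Longrightarrow> (LBINT t:{0..1}. unit_clamp (sqrt (2 * u) - t)) = u"
    and "u \<ge> 1/2 \<Longrightarrow> (LBINT t:{0..1}. unit_clamp (1 + (1 - sqrt (2 * (1 - u))) - t)) = u"
proof -
  assume "u \<le> 1/2"
  with assms show "(LBINT t:{0..1}. unit_clamp (sqrt (2 * u) - t)) = u"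
    using integral_unit_clamp_low[of "sqrt (2 * u)" "\<lambda>p. p"]
    by (simp add: integral_reflected_identity)
next
  assume u: "u \<ge> 1/2"
  define r where "r = sqrt (2 * (1 - u))"
  have r: "0 \<le> r" "r \<le> 1" "r\<^sup>2 = 2 * (1 - u)"
    using assms u by (auto simp: r_def)
  have "(LBINT t:{0..1}. unit_clamp (1 + (1 - r) - t)) = (1 - (1 - r)\<^sup>2) / 2 + (1 - r)"
    using r integral_unit_clamp_high[of "1 - r" "\<lambda>p. p"]
    by (simp add: integral_reflected_identity mono_on_def)
  also have "\<dots> = u"
    using r(3) by (simp add: power2_eq_square field_simps)
  finally show "(LBINT t:{0..1}. unit_clamp (1 + (1 - sqrt (2 * (1 - u))) - t)) = u"
    unfolding r_def .
qed

section \<open>Integrals of a two-copula over the unit square\<close>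

lemma two_copula_boundary:
  assumes "two_copula C" "t \<in> {0..1}"
  shows "C 0 t = 0" "C t 0 = 0" "C 1 t = t" "C t 1 = t"
  using assms by (auto simp: two_copula_def)

text \<open>Apply the rectangle inequality to a rectangle with one side on an axis, where the copula
  vanishes.\<close>

lemma two_copula_mono_on:
  assumes C: "two_copula C" and q: "q \<in> {0..1}"
  shows "mono_on {0..1} (\<lambda>p. C p q)" "mono_on {0..1} (C q)"
proof -
  have rect: "C x1 y1 + C x2 y2 - C x1 y2 - C x2 y1 \<ge> 0"
    if "0 \<le> x1" "x1 \<le> x2" "x2 \<le> 1" "0 \<le> y1" "y1 \<le> y2" "y2 \<le> 1" for x1 x2 y1 y2
    using C that by (auto simp: two_copula_def)
  show "mono_on {0..1} (\<lambda>p. C p q)"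
  proof (rule mono_onI)
    fix r s :: real assume "r \<in> {0..1}" "s \<in> {0..1}" "r \<le> s"
    then show "C r q \<le> C s q"
      using rect[of r s 0 q] q two_copula_boundary[OF C, of r] two_copula_boundary[OF C, of s] by auto
  qed
  show "mono_on {0..1} (C q)"
  proof (rule mono_onI)
    fix r s :: real assume "r \<in> {0..1}" "s \<in> {0..1}" "r \<le> s"
    then show "C q r \<le> C q s"
      using rect[of 0 q r s] q two_copula_boundary[OF C, of r] two_copula_boundary[OF C, of s] by auto
  qed
qed

text \<open>The inner integral inherits monotonicity in \<open>p\<close>, so the one-variable clamp
  lemmas apply to the outer integral too.\<close>

lemma mono_on_integral_two_copula:
  assumes C: "two_copula C"
  shows "mono_on {0..1} (\<lambda>p. LBINT t:{c..d}. C p (unit_clamp (y - t)))"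
proof (rule mono_onI)
  fix r s :: real assume h: "r \<in> {0..1}" "s \<in> {0..1}" "r \<le> s"
  then have "C r (unit_clamp z) \<le> C s (unit_clamp z)" for z
    using two_copula_mono_on(1)[OF C unit_clamp_mem, of z] by (auto simp: mono_on_def)
  then show "(LBINT t:{c..d}. C r (unit_clamp (y - t))) \<le> (LBINT t:{c..d}. C s (unit_clamp (y - t)))"
    using h C by (intro set_integral_mono set_integrable_mono_on_unit_clamp two_copula_mono_on)
qed

context
  fixes C :: "real \<Rightarrow> real \<Rightarrow> real"
  assumes C: "two_copula C"
begin

lemma integral_two_copula_0: "(LBINT t:{c..d}. C 0 (unit_clamp (y - t))) = 0"
  by (simp add: two_copula_boundary[OF C])

lemma integral_two_copula_1:
  "(LBINT t:{c..d}. C 1 (unit_clamp (y - t))) = (LBINT t:{c..d}. unit_clamp (y - t))"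
  by (simp add: two_copula_boundary[OF C])

lemma integral_two_copula_low:
  assumes "p \<in> {0..1}" "y \<in> {0..1}"
  shows "(LBINT t:{0..1}. C p (unit_clamp (y - t))) = (LBINT t:{0..y}. C p (y - t))"
  using assms by (intro integral_unit_clamp_low) (auto simp: two_copula_boundary[OF C])

lemma integral_two_copula_clamped:
  assumes "e \<in> {0..1}"
  shows "(LBINT t:{e..1}. C p (unit_clamp (1 + e - t))) = (LBINT t:{e..1}. C p (1 + e - t))"
  using assms by (intro set_lebesgue_integral_cong) auto

text \<open>On the strip below \<open>e\<close> the second argument is clamped to 1, and
  \<open>C p 1 = p\<close>.\<close>

lemma integral_two_copula_high:
  assumes "p \<in> {0..1}" "e \<in> {0..1}"
  shows "(LBINT t:{0..1}. C p (unit_clamp (1 + e - t))) =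
    (LBINT t:{e..1}. C p (unit_clamp (1 + e - t))) + e * p"
  using integral_unit_clamp_high[OF assms(2) two_copula_mono_on(2)[OF C assms(1)]]
    two_copula_boundary[OF C assms(1)] integral_two_copula_clamped[OF assms(2)]
  by simp

text \<open>Integrates the strip contribution \<open>e * p\<close> over \<open>t1\<close>. The point
  \<open>x\<close> stays arbitrary, so that both ranges of the first coordinate are covered.\<close>

lemma integral_integral_two_copula_high:
  assumes "e \<in> {0..1}"
  shows "(LBINT t1:{0..1}. (LBINT t2:{0..1}. C (unit_clamp (x - t1)) (unit_clamp (1 + e - t2)))) =
    (LBINT t1:{0..1}. (LBINT t2:{e..1}. C (unit_clamp (x - t1)) (unit_clamp (1 + e - t2)))) +
    (LBINT t:{0..1}. unit_clamp (x - t)) * e"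
proof -
  let ?\<Psi> = "\<lambda>p. LBINT t2:{e..1}. C p (unit_clamp (1 + e - t2))"
  have "(LBINT t1:{0..1}. (LBINT t2:{0..1}. C (unit_clamp (x - t1)) (unit_clamp (1 + e - t2)))) =
      (LBINT t1:{0..1}. ?\<Psi> (unit_clamp (x - t1)) + e * unit_clamp (x - t1))"
    by (simp only: integral_two_copula_high[OF unit_clamp_mem assms])
  also have "\<dots> = (LBINT t1:{0..1}. ?\<Psi> (unit_clamp (x - t1))) + (LBINT t1:{0..1}. e * unit_clamp (x - t1))"
  proof (rule set_integral_add)
    show "set_integrable lborel {0..1} (\<lambda>t1. ?\<Psi> (unit_clamp (x - t1)))"
      by (rule set_integrable_mono_on_unit_clamp[OF mono_on_integral_two_copula[OF C]])
    show "set_integrable lborel {0..1} (\<lambda>t1. e * unit_clamp (x - t1))"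
      using assms by (intro set_integrable_mono_on_unit_clamp) (auto intro!: mono_onI mult_left_mono)
  qed
  finally show ?thesis by (simp add: mult.commute)
qed

lemma integral_integral_two_copula_low_low:
  assumes "x \<in> {0..1}" "y \<in> {0..1}"
  shows "(LBINT t1:{0..1}. (LBINT t2:{0..1}. C (unit_clamp (x - t1)) (unit_clamp (y - t2)))) =
    (LBINT t1:{0..x}. (LBINT t2:{0..y}. C (x - t1) (y - t2)))"
proof -
  have "(LBINT t1:{0..1}. (LBINT t2:{0..1}. C (unit_clamp (x - t1)) (unit_clamp (y - t2)))) =
    (LBINT t1:{0..x}. (LBINT t2:{0..1}. C (x - t1) (unit_clamp (y - t2))))"
    using assms by (intro integral_unit_clamp_low) (auto simp: integral_two_copula_0)
  also have "\<dots> = (LBINT t1:{0..x}. (LBINT t2:{0..y}. C (x - t1) (y - t2)))"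
    using assms by (intro set_lebesgue_integral_cong) (auto simp: integral_two_copula_low)
  finally show ?thesis .
qed

lemma integral_integral_two_copula_low_high:
  assumes "x \<in> {0..1}" "e \<in> {0..1}"
  shows "(LBINT t1:{0..1}. (LBINT t2:{0..1}. C (unit_clamp (x - t1)) (unit_clamp (1 + e - t2)))) =
    (LBINT t1:{0..x}. (LBINT t2:{e..1}. C (x - t1) (1 + e - t2))) +
    (LBINT t:{0..1}. unit_clamp (x - t)) * e"
proof -
  have "(LBINT t1:{0..1}. (LBINT t2:{e..1}. C (unit_clamp (x - t1)) (unit_clamp (1 + e - t2)))) =
    (LBINT t1:{0..x}. (LBINT t2:{e..1}. C (x - t1) (unit_clamp (1 + e - t2))))"
    using assms by (intro integral_unit_clamp_low) (auto simp: integral_two_copula_0)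
  then show ?thesis
    by (simp only: integral_integral_two_copula_high[OF assms(2)] integral_two_copula_clamped[OF assms(2)])
qed

text \<open>On the strip \<open>t1 \<le> d\<close> the first argument is 1, and \<open>C 1\<close>
  is the identity on \<open>{0..1}\<close>, which leaves \<open>d\<close> times a marginal
  integral.\<close>

lemma integral_integral_two_copula_high_low:
  assumes "d \<in> {0..1}" "y \<in> {0..1}"
  shows "(LBINT t1:{0..1}. (LBINT t2:{0..1}. C (unit_clamp (1 + d - t1)) (unit_clamp (y - t2)))) =
    (LBINT t1:{d..1}. (LBINT t2:{0..y}. C (1 + d - t1) (y - t2))) +
    (LBINT t:{0..1}. unit_clamp (y - t)) * d"
proof -
  have "(LBINT t1:{0..1}. (LBINT t2:{0..1}. C (unit_clamp (1 + d - t1)) (unit_clamp (y - t2)))) =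
    (LBINT t1:{d..1}. (LBINT t2:{0..1}. C (1 + d - t1) (unit_clamp (y - t2)))) +
    d * (LBINT t2:{0..1}. C 1 (unit_clamp (y - t2)))"
    by (rule integral_unit_clamp_high[OF assms(1) mono_on_integral_two_copula[OF C]])
  also have "(LBINT t1:{d..1}. (LBINT t2:{0..1}. C (1 + d - t1) (unit_clamp (y - t2)))) =
    (LBINT t1:{d..1}. (LBINT t2:{0..y}. C (1 + d - t1) (y - t2)))"
    using assms by (intro set_lebesgue_integral_cong) (auto simp: integral_two_copula_low)
  finally show ?thesis by (simp add: integral_two_copula_1 mult.commute)
qed

text \<open>Each strip contributes a marginal integral times its width; the corner
  \<open>{0..d}\<close> by \<open>{0..e}\<close>, where the integrand is 1, lies in both strips,
  hence the correction \<open>- d * e\<close>.\<close>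

lemma integral_integral_two_copula_high_high:
  assumes "d \<in> {0..1}" "e \<in> {0..1}"
  shows "(LBINT t1:{0..1}. (LBINT t2:{0..1}. C (unit_clamp (1 + d - t1)) (unit_clamp (1 + e - t2)))) =
    (LBINT t1:{d..1}. (LBINT t2:{e..1}. C (1 + d - t1) (1 + e - t2))) +
    (LBINT t:{0..1}. unit_clamp (1 + d - t)) * e +
    (LBINT t:{0..1}. unit_clamp (1 + e - t)) * d - d * e"
proof -
  have "(LBINT t1:{0..1}. (LBINT t2:{e..1}. C (unit_clamp (1 + d - t1)) (unit_clamp (1 + e - t2)))) =
    (LBINT t1:{d..1}. (LBINT t2:{e..1}. C (1 + d - t1) (unit_clamp (1 + e - t2)))) +
    d * (LBINT t2:{e..1}. C 1 (unit_clamp (1 + e - t2)))"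
    by (rule integral_unit_clamp_high[OF assms(1) mono_on_integral_two_copula[OF C]])
  moreover have "(LBINT t:{0..1}. unit_clamp (1 + e - t)) =
    (LBINT t2:{e..1}. C 1 (unit_clamp (1 + e - t2))) + e"
    using integral_two_copula_high[of 1 e] assms(2) by (simp add: integral_two_copula_1)
  ultimately show ?thesis
    by (simp add: integral_integral_two_copula_high[OF assms(2)] algebra_simps
        flip: integral_two_copula_clamped[OF assms(2)])
qed

end

section \<open>The copula of the sums\<close>

theorem proposition1p2p7:
  fixes M :: "'a measure"
    and X Y Z1 Z2 :: "'a \<Rightarrow> real"
    and C C7 :: "real \<Rightarrow> real \<Rightarrow> real"
    and F1 F2 G1 G2 F7 F8 a b :: "real \<Rightarrow> real"
  assumes "prob_space M"
    and "X \<in> borel_measurable M" "Y \<in> borel_measurable M"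
    and "Z1 \<in> borel_measurable M" "Z2 \<in> borel_measurable M"
    and "prob_space.indep_var M borel (\<lambda>\<omega>. (X \<omega>, Y \<omega>)) borel (\<lambda>\<omega>. (Z1 \<omega>, Z2 \<omega>))"
    and "prob_space.indep_var M borel Z1 borel Z2"
    and "copula_of M X Y C"
    and "F1 = cdf (distr M borel X)" "F2 = cdf (distr M borel Y)"
    and "G1 = cdf (distr M borel Z1)" "G2 = cdf (distr M borel Z2)"
    and "F7 = cdf (distr M borel (\<lambda>\<omega>. X \<omega> + Z1 \<omega>))"
    and "F8 = cdf (distr M borel (\<lambda>\<omega>. Y \<omega> + Z2 \<omega>))"
    and "\<And>u v. u \<in> {0..1} \<Longrightarrow> v \<in> {0..1} \<Longrightarrow>
           C7 u v = (\<integral>t1. (\<integral>t2. C (ext_df F1 (df_inv F7 u - ereal t1))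
                                   (ext_df F2 (df_inv F8 v - ereal t2))
                            \<partial>interval_measure G2) \<partial>interval_measure G1)"
    and "\<And>x. a x = 1 - sqrt (2 * (1 - x))"
    and "\<And>x. b x = sqrt (2 * x)"
  shows
    "(\<forall>x y. C7 (F7 x) (F8 y) =
        measure M {\<omega> \<in> space M. X \<omega> + Z1 \<omega> \<le> x \<and> Y \<omega> + Z2 \<omega> \<le> y}) \<and>
     (continuous_on UNIV F7 \<and> continuous_on UNIV F8 \<longrightarrow>
        copula_of M (\<lambda>\<omega>. X \<omega> + Z1 \<omega>) (\<lambda>\<omega>. Y \<omega> + Z2 \<omega>) C7 \<and>
        (\<forall>D. copula_of M (\<lambda>\<omega>. X \<omega> + Z1 \<omega>) (\<lambda>\<omega>. Y \<omega> + Z2 \<omega>) D \<longrightarrow>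
           (\<forall>u\<in>{0..1}. \<forall>v\<in>{0..1}. D u v = C7 u v))) \<and>
     ((\<forall>V\<in>{X, Y, Z1, Z2}. distr M borel V = uniform_measure lborel {0<..<1}) \<longrightarrow>
        (\<forall>u\<in>{0..1}. \<forall>v\<in>{0..1}.
           (u \<le> 1/2 \<and> v \<le> 1/2 \<longrightarrow>
              C7 u v = (LBINT t1:{0..b u}. (LBINT t2:{0..b v}. C (b u - t1) (b v - t2)))) \<and>
           (u \<le> 1/2 \<and> v \<ge> 1/2 \<longrightarrow>
              C7 u v = (LBINT t1:{0..b u}. (LBINT t2:{a v..1}. C (b u - t1) (1 + a v - t2)))
                       + u * a v) \<and>
           (u \<ge> 1/2 \<and> v \<le> 1/2 \<longrightarrow>
              C7 u v = (LBINT t1:{a u..1}. (LBINT t2:{0..b v}. C (1 + a u - t1) (b v - t2)))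
                       + v * a u) \<and>
           (u \<ge> 1/2 \<and> v \<ge> 1/2 \<longrightarrow>
              C7 u v = (LBINT t1:{a u..1}. (LBINT t2:{a v..1}. C (1 + a u - t1) (1 + a v - t2)))
                       + u * a v + v * a u - a u * a v)))"
proof -
  interpret prob_space M by fact
  note [measurable] = assms(2-5)
  let ?V = "\<lambda>\<omega>. X \<omega> + Z1 \<omega>" and ?W = "\<lambda>\<omega>. Y \<omega> + Z2 \<omega>"
  have V[measurable]: "random_variable borel ?V" and W[measurable]: "random_variable borel ?W"
    by measurable
  interpret V: real_distribution "distr M borel ?V" by simp
  interpret W: real_distribution "distr M borel ?W" by simp
  have F7: "F7 = cdf (distr M borel ?V)" and F8: "F8 = cdf (distr M borel ?W)"
    by fact+
  let ?J = "\<lambda>x y. prob {\<omega> \<in> space M. ereal (?V \<omega>) \<le> x \<and> ereal (?W \<omega>) \<le> y}"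
  have ext7: "ext_df F7 x = prob {\<omega> \<in> space M. ereal (?V \<omega>) \<le> x}" for x
    unfolding F7 by (rule ext_df_distr[OF V])
  have ext8: "ext_df F8 y = prob {\<omega> \<in> space M. ereal (?W \<omega>) \<le> y}" for y
    unfolding F8 by (rule ext_df_distr[OF W])
  have J: "?J x y = (\<integral>t1. (\<integral>t2. C (ext_df F1 (x - ereal t1)) (ext_df F2 (y - ereal t2))
      \<partial>distr M borel Z2) \<partial>distr M borel Z1)" for x y
    unfolding assms(9,10) copula_of_ext_df[OF assms(2,3,8)]
    by (rule prob_add_le_convolution[OF assms(6,7)]) measurable
  have C7: "C7 u v = ?J (df_inv F7 u) (df_inv F8 v)" if "u \<in> {0..1}" "v \<in> {0..1}" for u v
    unfolding J assms(15)[OF that] assms(11,12) by (simp add: interval_measure_cdf)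
  have C7_ext: "C7 (ext_df F7 x) (ext_df F8 y) = ?J x y" for x y
  proof -
    have "C7 (ext_df F7 x) (ext_df F8 y) = ?J (df_inv F7 (ext_df F7 x)) (df_inv F8 (ext_df F8 y))"
      by (rule C7) (simp_all add: ext7 ext8)
    \<comment> \<open>The point \<open>x\<close> itself witnesses that its level set is nonempty, so
      \<open>df_inv\<close> returns a point of the same level, and \<open>?J\<close> depends only on
      levels.\<close>
    also have "\<dots> = ?J x y"
      using V.ext_df_df_inv[OF refl, of x] W.ext_df_df_inv[OF refl, of y]
      by (intro joint_prob_cong[OF V W]) (simp_all flip: ext7 ext8 F7 F8)
    finally show ?thesis .
  qed
  have sklar: "C7 (F7 x) (F8 y) = prob {\<omega> \<in> space M. ?V \<omega> \<le> x \<and> ?W \<omega> \<le> y}" for x y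
    using C7_ext[of "ereal x" "ereal y"] by (simp add: ext_df_def)
  have copula: "copula_of M ?V ?W C7 \<and>
      (\<forall>D. copula_of M ?V ?W D \<longrightarrow> (\<forall>u\<in>{0..1}. \<forall>v\<in>{0..1}. D u v = C7 u v))"
    if "continuous_on UNIV F7 \<and> continuous_on UNIV F8"
  proof -
    \<comment> \<open>Continuity enters here: every level in \<open>{0..1}\<close> is attained, so
      \<open>df_inv\<close> is a right inverse on all of \<open>{0..1}\<close>.\<close>
    have surj7: "\<exists>x. ext_df F7 x = u" and surj8: "\<exists>y. ext_df F8 y = u" if "u \<in> {0..1}" for u
      using V.ext_df_cdf_surj W.ext_df_cdf_surj \<open>continuous_on UNIV F7 \<and> continuous_on UNIV F8\<close> that
      unfolding F7 F8 by auto
    have "two_copula C7"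
    proof (rule two_copula_joint_prob[OF V W _ _ C7])
      show "prob {\<omega> \<in> space M. ereal (?V \<omega>) \<le> df_inv F7 u} = u" if "u \<in> {0..1}" for u
        using surj7[OF that] V.ext_df_df_inv unfolding ext7[symmetric] F7 by blast
      show "prob {\<omega> \<in> space M. ereal (?W \<omega>) \<le> df_inv F8 u} = u" if "u \<in> {0..1}" for u
        using surj8[OF that] W.ext_df_df_inv unfolding ext8[symmetric] F8 by blast
    qed
    then have "copula_of M ?V ?W C7"
      using sklar by (simp add: copula_of_def F7 F8)
    \<comment> \<open>Both sides equal the joint probability at preimages of \<open>u\<close> and
      \<open>v\<close>.\<close>
    moreover have "D u v = C7 u v"
      if D: "copula_of M ?V ?W D" and uv: "u \<in> {0..1}" "v \<in> {0..1}" for D u v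
    proof -
      obtain x y where "ext_df F7 x = u" "ext_df F8 y = v"
        using surj7 surj8 uv by blast
      then show ?thesis
        using copula_of_ext_df[OF V W D, of x y] C7_ext[of x y] by (simp add: F7 F8)
    qed
    ultimately show ?thesis by blast
  qed
  have uniform: "(u \<le> 1/2 \<and> v \<le> 1/2 \<longrightarrow>
              C7 u v = (LBINT t1:{0..b u}. (LBINT t2:{0..b v}. C (b u - t1) (b v - t2)))) \<and>
           (u \<le> 1/2 \<and> v \<ge> 1/2 \<longrightarrow>
              C7 u v = (LBINT t1:{0..b u}. (LBINT t2:{a v..1}. C (b u - t1) (1 + a v - t2)))
                       + u * a v) \<and>
           (u \<ge> 1/2 \<and> v \<le> 1/2 \<longrightarrow>
              C7 u v = (LBINT t1:{a u..1}. (LBINT t2:{0..b v}. C (1 + a u - t1) (b v - t2)))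
                       + v * a u) \<and>
           (u \<ge> 1/2 \<and> v \<ge> 1/2 \<longrightarrow>
              C7 u v = (LBINT t1:{a u..1}. (LBINT t2:{a v..1}. C (1 + a u - t1) (1 + a v - t2)))
                       + u * a v + v * a u - a u * a v)"
    if unif: "\<forall>V\<in>{X, Y, Z1, Z2}. distr M borel V = uniform_measure lborel {0<..<1}"
      and u: "u \<in> {0..1}" and v: "v \<in> {0..1}" for u v
  proof -
    have cop: "two_copula C"
      using assms(8) by (simp add: copula_of_def)
    have F: "F1 = unit_clamp" "F2 = unit_clamp"
      using unif assms(9,10) by (simp_all add: cdf_uniform_unit)
    have N: "distr M borel Z1 = uniform_measure lborel {0<..<1}"
        "distr M borel Z2 = uniform_measure lborel {0<..<1}"
      using unif by simp_all
    interpret U: prob_space "uniform_measure lborel {0<..<1::real}"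
      by (rule prob_space_uniform_measure) simp_all
    have clamp: "mono_on {0..1} (\<lambda>p::real. p)"
      by (simp add: mono_on_def)
    have F7_eq: "F7 x = (LBINT t:{0..1}. unit_clamp (x - t))" for x
    proof -
      \<comment> \<open>With the second bound infinite, \<open>C p 1 = p\<close> reduces the double
        integral to a single one.\<close>
      have "F7 x = ?J (ereal x) \<infinity>"
        using ext7[of "ereal x"] by (simp add: ext_df_def)
      also have "\<dots> = (\<integral>t. unit_clamp (x - t) \<partial>uniform_measure lborel {0<..<1})"
        unfolding J N F by (simp add: ext_df_def two_copula_boundary[OF cop] U.prob_space)
      finally show ?thesis
        using integral_uniform_unit borel_measurable_mono_on_unit_clamp[OF clamp] by simp
    qed
    have F8_eq: "F8 y = (LBINT t:{0..1}. unit_clamp (y - t))" for y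
    proof -
      have "F8 y = ?J \<infinity> (ereal y)"
        using ext8[of "ereal y"] by (simp add: ext_df_def)
      also have "\<dots> = (\<integral>t. unit_clamp (y - t) \<partial>uniform_measure lborel {0<..<1})"
        unfolding J N F by (simp add: ext_df_def two_copula_boundary[OF cop] U.prob_space)
      finally show ?thesis
        using integral_uniform_unit borel_measurable_mono_on_unit_clamp[OF clamp] by simp
    qed
    \<comment> \<open>Evaluating at values of \<open>F7\<close> and \<open>F8\<close> avoids
      computing \<open>df_inv\<close>; explicit preimages of \<open>u\<close> and \<open>v\<close>
      are substituted afterwards.\<close>
    have C7_eq: "C7 (F7 x) (F8 y) =
        (LBINT t1:{0..1}. (LBINT t2:{0..1}. C (unit_clamp (x - t1)) (unit_clamp (y - t2))))" for x y
    proof -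
      have inner: "(\<integral>t2. C p (unit_clamp (y - t2)) \<partial>uniform_measure lborel {0<..<1}) =
          (LBINT t2:{0..1}. C p (unit_clamp (y - t2)))" if "p \<in> {0..1}" for p
        by (intro integral_uniform_unit borel_measurable_mono_on_unit_clamp two_copula_mono_on cop that)
      have "C7 (F7 x) (F8 y) = (\<integral>t1. (\<integral>t2. C (unit_clamp (x - t1)) (unit_clamp (y - t2))
          \<partial>uniform_measure lborel {0<..<1}) \<partial>uniform_measure lborel {0<..<1})"
        using C7_ext[of "ereal x" "ereal y"] unfolding J N F by (simp add: ext_df_def)
      also have "\<dots> = (\<integral>t1. (LBINT t2:{0..1}. C (unit_clamp (x - t1)) (unit_clamp (y - t2)))
          \<partial>uniform_measure lborel {0<..<1})"
        by (simp only: inner[OF unit_clamp_mem])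
      also have "\<dots> =
          (LBINT t1:{0..1}. (LBINT t2:{0..1}. C (unit_clamp (x - t1)) (unit_clamp (y - t2))))"
        by (intro integral_uniform_unit borel_measurable_mono_on_unit_clamp mono_on_integral_two_copula cop)
      finally show ?thesis .
    qed
    \<comment> \<open>The preimages: \<open>b s\<close> for levels up to one half,
      \<open>1 + a s\<close> for levels from one half on.\<close>
    have b: "b s \<in> {0..1}" "(LBINT t:{0..1}. unit_clamp (b s - t)) = s"
      "F7 (b s) = s" "F8 (b s) = s" if "s \<in> {0..1}" "s \<le> 1/2" for s
      using that integral_unit_clamp_sqrt(1)[of s] by (simp_all add: assms(17) F7_eq F8_eq)
    have a: "a s \<in> {0..1}" "(LBINT t:{0..1}. unit_clamp (1 + a s - t)) = s"
      "F7 (1 + a s) = s" "F8 (1 + a s) = s" if "s \<in> {0..1}" "s \<ge> 1/2" for s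
      using that integral_unit_clamp_sqrt(2)[of s] by (simp_all add: assms(16) F7_eq F8_eq)
    show ?thesis
    proof (intro conjI impI; elim conjE)
      assume h: "u \<le> 1/2" "v \<le> 1/2"
      note bu = b[OF u h(1)] and bv = b[OF v h(2)]
      show "C7 u v = (LBINT t1:{0..b u}. (LBINT t2:{0..b v}. C (b u - t1) (b v - t2)))"
        using C7_eq[of "b u" "b v"] integral_integral_two_copula_low_low[OF cop bu(1) bv(1)]
        by (simp only: bu bv)
    next
      assume h: "u \<le> 1/2" "v \<ge> 1/2"
      note bu = b[OF u h(1)] and av = a[OF v h(2)]
      show "C7 u v = (LBINT t1:{0..b u}. (LBINT t2:{a v..1}. C (b u - t1) (1 + a v - t2))) + u * a v"
        using C7_eq[of "b u" "1 + a v"] integral_integral_two_copula_low_high[OF cop bu(1) av(1)]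
        by (simp only: bu av)
    next
      assume h: "u \<ge> 1/2" "v \<le> 1/2"
      note au = a[OF u h(1)] and bv = b[OF v h(2)]
      show "C7 u v = (LBINT t1:{a u..1}. (LBINT t2:{0..b v}. C (1 + a u - t1) (b v - t2))) + v * a u"
        using C7_eq[of "1 + a u" "b v"] integral_integral_two_copula_high_low[OF cop au(1) bv(1)]
        by (simp only: au bv)
    next
      assume h: "u \<ge> 1/2" "v \<ge> 1/2"
      note au = a[OF u h(1)] and av = a[OF v h(2)]
      show "C7 u v = (LBINT t1:{a u..1}. (LBINT t2:{a v..1}. C (1 + a u - t1) (1 + a v - t2)))
          + u * a v + v * a u - a u * a v"
        using C7_eq[of "1 + a u" "1 + a v"] integral_integral_two_copula_high_high[OF cop au(1) av(1)]
        by (simp only: au av)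
    qed
  qed
  show ?thesis
    using sklar copula uniform by blast
qed

end
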